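(* Let $1\le k\le n$, let $H:\mathbb{R}^{2n}\to\mathbb{R}$ be smooth, and let $A\in\mathbb{R}^{2n\times 2k}$ satisfy $A^TJ_{2n}A=J_{2k}$. If $x_*\in\mathrm{Range}(A)$ is a strict local minimum or a strict local maximum of $H$, then $x_*$ is a stable equilibrium of the original Hamiltonian system $\dot x=J_{2n}\nabla_xH(x)$, and it is also a stable equilibrium of the reduced system $\dot z=J_{2k}\nabla_z\tilde H(z)$ with $\tilde H(z)=H(Az)$; the latter means that the point $z_*=A^+x_*$ (the unique $z_*\in\mathbb{R}^{2k}$ with $Az_*=x_*$) is a stable equilibrium of the reduced system.
   Context: For a positive integer $m$, $J_{2m}=\begin{bmatrix}0_m & I_m\\ -I_m & 0_m\end{bmatrix}$. For $A\in\mathbb{R}^{2n\times 2k}$, the symplectic inverse is $A^+:=J_{2k}^TA^TJ_{2n}\in\mathbb{R}^{2k\times 2n}$. The system $\dot z=J_{2k}\nabla_z(H\circ A)(z)$ with $A^TJ_{2n}A=J_{2k}$ is called the reduced system constructed by the symplectic projection. Stable is in the sense of Lyapunov: an equilibrium $y_*$ is stable if for every neighborhood $U$ of $y_*$ there is a neighborhood $U'$ of $y_*$ such that every solution starting in $U'$ stays in $U$. *)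

theory Defs
  imports "HOL-Analysis.Analysis"
begin

text \<open>
  The space \<open>\<real>\<^sup>2\<^sup>m\<close> is \<open>real ^ ('m + 'm)\<close> with \<open>m = CARD('m)\<close>: the indices \<open>Inl i\<close> are
  the first \<open>m\<close> coordinates and the indices \<open>Inr i\<close> the last \<open>m\<close>.  A \<open>2n \<times> 2k\<close> matrix has
  type \<open>real ^ ('k + 'k) ^ ('n + 'n)\<close>.
\<close>

definition symplectic_J :: "real ^ ('m::finite + 'm) ^ ('m + 'm)" where
  "symplectic_J = (\<chi> r c. case (r, c) of
       (Inl i, Inr j) \<Rightarrow> (mat 1 :: real ^ 'm ^ 'm) $ i $ j
     | (Inr i, Inl j) \<Rightarrow> - ((mat 1 :: real ^ 'm ^ 'm) $ i $ j)
     | _ \<Rightarrow> 0)"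

definition symplectic_inverse ::
    "real ^ ('k::finite + 'k) ^ ('n::finite + 'n) \<Rightarrow> real ^ ('n + 'n) ^ ('k + 'k)" where
  "symplectic_inverse A = transpose symplectic_J ** transpose A ** symplectic_J"

text \<open>\<open>times_cont_differentiable r f\<close>: \<open>f\<close> is of class \<open>C\<^sup>r\<close>.  In finite dimension continuity of the derivative
  is the same as continuity of each directional derivative.\<close>

primrec times_cont_differentiable ::
    "nat \<Rightarrow> ('a::euclidean_space \<Rightarrow> real) \<Rightarrow> bool" where
  "times_cont_differentiable 0 f \<longleftrightarrow> continuous_on UNIV f"
| "times_cont_differentiable (Suc r) f \<longleftrightarrow>
     (\<forall>x. f differentiable (at x)) \<and>
     (\<forall>v. times_cont_differentiable r (\<lambda>x. frechet_derivative f (at x) v))"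

definition smooth :: "('a::euclidean_space \<Rightarrow> real) \<Rightarrow> bool" where
  "smooth f \<longleftrightarrow> (\<forall>r. times_cont_differentiable r f)"

text \<open>Meaningful at points of differentiability only, where the vector is unique.\<close>

definition gradient :: "('a::euclidean_space \<Rightarrow> real) \<Rightarrow> 'a \<Rightarrow> 'a" where
  "gradient f x = (THE D. GDERIV f x :> D)"

definition hamiltonian_field ::
    "(real ^ ('m::finite + 'm) \<Rightarrow> real) \<Rightarrow> real ^ ('m + 'm) \<Rightarrow> real ^ ('m + 'm)" where
  "hamiltonian_field H x = symplectic_J *v gradient H x"

text \<open>
  A solution lives on an arbitrary interval \<open>I\<close>; it need be neither maximal nor global.  At an
  end point belonging to \<open>I\<close> the derivative is one-sided.
\<close>

definition ode_solution ::
    "('a::euclidean_space \<Rightarrow> 'a) \<Rightarrow> (real \<Rightarrow> 'a) \<Rightarrow> real set \<Rightarrow> bool" where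
  "ode_solution F y I \<longleftrightarrow> is_interval I \<and>
     (\<forall>t\<in>I. (y has_vector_derivative F (y t)) (at t within I))"

definition equilibrium :: "('a::euclidean_space \<Rightarrow> 'a) \<Rightarrow> 'a \<Rightarrow> bool" where
  "equilibrium F p \<longleftrightarrow> F p = 0"

text \<open>
  Lyapunov stability, forward in time from the starting time \<open>t0\<close>.  Since all solutions are
  considered, including those that exist for a finite time only, leaving \<open>U\<close> is
  excluded for as long as a solution exists.
\<close>

definition stable_equilibrium :: "('a::euclidean_space \<Rightarrow> 'a) \<Rightarrow> 'a \<Rightarrow> bool" where
  "stable_equilibrium F p \<longleftrightarrow> equilibrium F p \<and>
     (\<forall>U. open U \<and> p \<in> U \<longrightarrow>
       (\<exists>U'. open U' \<and> p \<in> U' \<and>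
         (\<forall>y I t0. ode_solution F y I \<and> t0 \<in> I \<and> y t0 \<in> U' \<longrightarrow>
           (\<forall>t\<in>I. t0 \<le> t \<longrightarrow> y t \<in> U))))"

definition strict_local_min :: "('a::topological_space \<Rightarrow> real) \<Rightarrow> 'a \<Rightarrow> bool" where
  "strict_local_min f p \<longleftrightarrow> (\<forall>\<^sub>F x in at p. f p < f x)"

definition strict_local_max :: "('a::topological_space \<Rightarrow> real) \<Rightarrow> 'a \<Rightarrow> bool" where
  "strict_local_max f p \<longleftrightarrow> (\<forall>\<^sub>F x in at p. f x < f p)"

end

theory Submission
  imports Defs
begin

text \<open>
  The Hamiltonian is constant along solutions, since \<open>\<nabla>H \<bullet> J \<nabla>H = 0\<close> by skew symmetry of \<open>J\<close>.
  On a small sphere about a strict local minimum \<open>p\<close> it is bounded below by some \<open>m > H p\<close>, so a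
  solution that starts inside the sphere with energy below \<open>m\<close> can never cross it; a strict
  maximum is a strict minimum of \<open>-H\<close>.  The symplectic inverse is a left inverse of \<open>A\<close>, so
  \<open>A\<close> is injective and the extremum is inherited by \<open>H \<circ> A\<close>, to which the same argument applies.
\<close>

text \<open>The definite description in \<open>gradient\<close> needs existence and uniqueness. The
  linear functional \<open>f'\<close> is represented by the vector \<open>adjoint f' 1\<close>, and
  a vector is determined by its inner products.\<close>

lemma GDERIV_gradient:
  fixes f :: "'a::euclidean_space \<Rightarrow> real"
  assumes "f differentiable (at x)"
  shows "GDERIV f x :> gradient f x"
proof -
  obtain f' where f': "(f has_derivative f') (at x)"
    using assms by (auto simp: differentiable_def)
  have "f' = (\<lambda>h. h \<bullet> adjoint f' 1)"
    using adjoint_works[OF has_derivative_linear[OF f'], of _ 1] by auto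
  then have ex: "GDERIV f x :> adjoint f' 1"
    using f' by (simp add: gderiv_def)
  show ?thesis
    unfolding gradient_def
  proof (rule theI)
    show "GDERIV f x :> adjoint f' 1" by (rule ex)
  next
    fix D assume "GDERIV f x :> D"
    then have "(\<lambda>h. h \<bullet> D) = (\<lambda>h. h \<bullet> adjoint f' 1)"
      using ex unfolding gderiv_def by (rule has_derivative_unique)
    then show "D = adjoint f' 1"
      by (metis vector_eq_ldot)
  qed
qed

lemma gradient_eq_0_at_strict_extremum:
  fixes f :: "'a::euclidean_space \<Rightarrow> real"
  assumes diff: "f differentiable (at p)"
    and ext: "strict_local_min f p \<or> strict_local_max f p"
  shows "gradient f p = 0"
proof -
  \<comment> \<open>The strict inequality holds on a punctured neighbourhood only; weakened to
    \<open>\<le>\<close> it holds at \<open>p\<close> as well.\<close>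
  obtain S where S: "open S" "p \<in> S"
    and le: "(\<forall>y\<in>S. f y \<le> f p) \<or> (\<forall>y\<in>S. f p \<le> f y)"
    using ext unfolding strict_local_min_def strict_local_max_def eventually_at_topological
    by (elim disjE exE conjE) (metis UNIV_I less_imp_le order_refl)+
  have "(f has_derivative (\<lambda>h. h \<bullet> gradient f p)) (at p)"
    using GDERIV_gradient[OF diff] by (simp add: gderiv_def)
  \<comment> \<open>The derivative vanishes in every direction, in particular in the direction
    \<open>gradient f p\<close> itself.\<close>
  from differential_zero_maxmin[OF S(2,1) this le] show ?thesis
    by (metis inner_eq_zero_iff)
qed

text \<open>Kept abstract in \<open>F\<close> and \<open>V\<close> so that the conserved quantity
  can be \<open>H\<close> at a minimum and \<open>- H\<close> at a maximum while the field stays the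
  same.\<close>

lemma stable_equilibrium_if_conserved:
  fixes V :: "'a::euclidean_space \<Rightarrow> real"
  assumes cont: "continuous_on UNIV V"
    and eq: "equilibrium F p"
    and cons: "\<And>y I s t. ode_solution F y I \<Longrightarrow> s \<in> I \<Longrightarrow> t \<in> I \<Longrightarrow> V (y s) = V (y t)"
    and minp: "strict_local_min V p"
  shows "stable_equilibrium F p"
  unfolding stable_equilibrium_def
proof (intro conjI allI impI)
  show "equilibrium F p" by (rule eq)
next
  fix U assume U: "open U \<and> p \<in> U"
  obtain S where S: "open S" "p \<in> S" "\<And>x. x \<in> S \<Longrightarrow> x \<noteq> p \<Longrightarrow> V p < V x"
    using minp unfolding strict_local_min_def eventually_at_topological by auto
  have "open (U \<inter> S)" "p \<in> U \<inter> S" using U S by auto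
  then obtain r where r: "r > 0" "cball p r \<subseteq> U \<inter> S"
    by (meson open_contains_cball)
  \<comment> \<open>A Euclidean space has positive dimension, so the sphere is nonempty and, being
    compact, carries a minimiser \<open>q\<close> of \<open>V\<close>.\<close>
  have "sphere p r \<noteq> {}" using r by simp
  then obtain q where q: "q \<in> sphere p r" "\<And>x. x \<in> sphere p r \<Longrightarrow> V q \<le> V x"
    using continuous_attains_inf[OF compact_sphere _ continuous_on_subset[OF cont]] by blast
  have "q \<in> cball p r" "q \<noteq> p" using q(1) r(1) by auto
  then have Vq: "V p < V q" using S(3) r(2) by blast
  define U' where "U' = ball p r \<inter> {x. V x < V q}"
  have "open {x. V x < V q}"
    by (rule open_Collect_less) (auto intro: cont)
  then have "open U'" "p \<in> U'" using r Vq by (auto simp: U'_def)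
  moreover have "y t \<in> U"
    if sol: "ode_solution F y I" and t0: "t0 \<in> I" "y t0 \<in> U'" and t: "t \<in> I" "t0 \<le> t" for y I t0 t
  proof -
    have "{t0..t} \<subseteq> I"
      using sol t0(1) t(1) unfolding ode_solution_def is_interval_1 by (meson atLeastAtMost_iff subsetI)
    moreover have "continuous_on I y"
      using sol unfolding ode_solution_def continuous_on_eq_continuous_within
      by (metis has_vector_derivative_continuous)
    ultimately have cy: "continuous_on {t0..t} (\<lambda>s. dist p (y s))"
      by (intro continuous_intros) (rule continuous_on_subset)
    \<comment> \<open>Otherwise the distance to \<open>p\<close>, continuous along the solution,
      takes the value \<open>r\<close> at some time \<open>s\<close>. There \<open>V\<close> is at
      least \<open>V q\<close>, but by conservation it still has its initial value, which is below
      \<open>V q\<close>.\<close>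
    have "dist p (y t) < r"
    proof (rule ccontr)
      assume "\<not> dist p (y t) < r"
      moreover have "dist p (y t0) \<le> r" using t0(2) by (simp add: U'_def)
      ultimately obtain s where s: "s \<in> {t0..t}" "dist p (y s) = r"
        using IVT'[OF _ _ t(2) cy] by (metis atLeastAtMost_iff not_less)
      then have "V q \<le> V (y s)" using q(2) by simp
      also have "\<dots> = V (y t0)" using cons[OF sol] s(1) t0(1) \<open>{t0..t} \<subseteq> I\<close> by blast
      also have "\<dots> < V q" using t0(2) by (simp add: U'_def)
      finally show False by simp
    qed
    then show ?thesis using r(2) by auto
  qed
  ultimately show "\<exists>U'. open U' \<and> p \<in> U' \<and>
      (\<forall>y I t0. ode_solution F y I \<and> t0 \<in> I \<and> y t0 \<in> U' \<longrightarrow> (\<forall>t\<in>I. t0 \<le> t \<longrightarrow> y t \<in> U))"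
    by blast
qed

lemma symplectic_J_nth:
  "symplectic_J $ Inl i $ Inl j = 0"
  "symplectic_J $ Inr i $ Inr j = 0"
  "symplectic_J $ Inl i $ Inr j = (if i = j then 1 else 0)"
  "symplectic_J $ Inr i $ Inl j = (if i = j then - 1 else 0)"
  by (simp_all add: symplectic_J_def mat_def)

lemma transpose_symplectic_J: "transpose symplectic_J = - symplectic_J"
  by (auto simp: vec_eq_iff transpose_def symplectic_J_def mat_def split: sum.splits)

lemma symplectic_J_inner_self: "v \<bullet> (symplectic_J *v v) = 0"
proof -
  have "v \<bullet> (symplectic_J *v v) = (transpose symplectic_J *v v) \<bullet> v"
    by (metis dot_lmul_matrix transpose_matrix_vector)
  also have "\<dots> = - (v \<bullet> (symplectic_J *v v))"
    by (simp add: transpose_symplectic_J inner_vec_def matrix_vector_mult_def sum_negf mult.commute)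
  finally show ?thesis by simp
qed

lemma transpose_symplectic_J_mult:
  "transpose symplectic_J ** symplectic_J = (mat 1 :: real ^ ('m::finite + 'm) ^ ('m + 'm))"
proof -
  \<comment> \<open>Splitting the index sum into its two halves reduces the product to a computation
    with 2 by 2 blocks.\<close>
  have sum_UNIV: "(\<Sum>k\<in>UNIV. f k) = (\<Sum>i\<in>UNIV. f (Inl i)) + (\<Sum>i\<in>UNIV. f (Inr i))"
    for f :: "'m + 'm \<Rightarrow> real"
    unfolding UNIV_Plus_UNIV[symmetric] by (subst sum.Plus) simp_all
  have delta: "(if b then c else 0) * x = (if b then c * x else 0)" for b and c x :: real
    by simp
  have "(transpose symplectic_J ** symplectic_J) $ i $ j = (mat 1 :: real ^ ('m + 'm) ^ ('m + 'm)) $ i $ j"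
    for i j :: "'m + 'm"
    by (cases i; cases j)
      (simp_all add: matrix_matrix_mult_def transpose_def symplectic_J_nth mat_def sum_UNIV delta)
  then show ?thesis by (simp add: vec_eq_iff)
qed

text \<open>Reassociating, \<open>J\<^sup>T (A\<^sup>T J A) = J\<^sup>T J\<close>, which is the
  identity.\<close>

lemma symplectic_inverse_mult:
  assumes "transpose A ** symplectic_J ** A = symplectic_J"
  shows "symplectic_inverse A ** A = mat 1"
  using assms unfolding symplectic_inverse_def
  by (metis matrix_mul_assoc transpose_symplectic_J_mult)

lemma hamiltonian_conserved:
  fixes H :: "real ^ ('m::finite + 'm) \<Rightarrow> real"
  assumes diff: "\<And>x. H differentiable (at x)"
    and sol: "ode_solution (hamiltonian_field H) y I" and "s \<in> I" "t \<in> I"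
  shows "H (y s) = H (y t)"
proof -
  \<comment> \<open>By the chain rule the derivative is \<open>h\<close> times
    \<open>\<nabla>H \<bullet> J \<nabla>H\<close>, which is zero. It is taken within
    \<open>I\<close> because \<open>I\<close> may contain its end points; convexity of
    \<open>I\<close> then gives constancy.\<close>
  have "((\<lambda>u. H (y u)) has_derivative (\<lambda>h. 0)) (at u within I)" if "u \<in> I" for u
  proof -
    let ?G = "gradient H (y u)"
    have "(y has_derivative (\<lambda>h. h *\<^sub>R (symplectic_J *v ?G))) (at u within I)"
      using sol that unfolding ode_solution_def has_vector_derivative_def hamiltonian_field_def by blast
    moreover have "(H has_derivative (\<lambda>h. h \<bullet> ?G)) (at (y u))"
      using GDERIV_gradient[OF diff] by (simp add: gderiv_def)
    ultimately show ?thesis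
      using has_derivative_compose by (fastforce simp: symplectic_J_inner_self inner_commute)
  qed
  moreover have "convex I"
    using sol by (simp add: ode_solution_def is_interval_convex)
  ultimately have "\<exists>c. \<forall>u\<in>I. H (y u) = c"
    by (rule has_derivative_zero_constant[rotated])
  then show ?thesis using assms(3,4) by auto
qed

lemma stable_equilibrium_hamiltonian:
  fixes H :: "real ^ ('m::finite + 'm) \<Rightarrow> real"
  assumes diff: "\<And>x. H differentiable (at x)"
    and ext: "strict_local_min H p \<or> strict_local_max H p"
  shows "stable_equilibrium (hamiltonian_field H) p"
proof -
  have cont: "continuous_on UNIV H"
    using diff by (simp add: continuous_at_imp_continuous_on differentiable_imp_continuous_within)
  have eq: "equilibrium (hamiltonian_field H) p"
    using gradient_eq_0_at_strict_extremum[OF diff ext]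
    by (simp add: equilibrium_def hamiltonian_field_def)
  note cons = hamiltonian_conserved[OF diff]
  from ext show ?thesis
  proof
    assume "strict_local_min H p"
    then show ?thesis
      by (intro stable_equilibrium_if_conserved[OF cont eq]) (rule cons)
  next
    assume "strict_local_max H p"
    then have "strict_local_min (\<lambda>x. - H x) p"
      by (simp add: strict_local_min_def strict_local_max_def)
    moreover have "- H (y s) = - H (y t)"
      if "ode_solution (hamiltonian_field H) y I" "s \<in> I" "t \<in> I" for y I s t
      using cons[OF that] by simp
    ultimately show ?thesis
      by (intro stable_equilibrium_if_conserved[OF continuous_on_minus[OF cont] eq])
  qed
qed

theorem theorem3p10:
  fixes H :: "real ^ ('n::finite + 'n) \<Rightarrow> real"
    and A :: "real ^ ('k::finite + 'k) ^ ('n + 'n)"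
    and x_star :: "real ^ ('n + 'n)"
  assumes "1 \<le> CARD('k)" and "CARD('k) \<le> CARD('n)"
    and "smooth H"
    and "transpose A ** symplectic_J ** A = symplectic_J"
    and "x_star \<in> range (\<lambda>z. A *v z)"
    and "strict_local_min H x_star \<or> strict_local_max H x_star"
  shows "stable_equilibrium (hamiltonian_field H) x_star \<and>
    (A *v (symplectic_inverse A *v x_star) = x_star \<and>
     (\<forall>z. A *v z = x_star \<longrightarrow> z = symplectic_inverse A *v x_star)) \<and>
    stable_equilibrium (hamiltonian_field (\<lambda>z. H (A *v z))) (symplectic_inverse A *v x_star)"
proof -
  let ?z = "symplectic_inverse A *v x_star"
  have diff: "H differentiable (at x)" for x
    using assms(3) unfolding smooth_def by (metis times_cont_differentiable.simps(2))
  have left_inv: "symplectic_inverse A *v (A *v z) = z" for z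
    using symplectic_inverse_mult[OF assms(4)] by (simp add: matrix_vector_mul_assoc)
  then have Az: "A *v ?z = x_star" using assms(5) by auto
  \<comment> \<open>Injectivity of \<open>A\<close> is essential here: points other than
    \<open>A\<^sup>+ x_star\<close> must not be sent to \<open>x_star\<close>, where the strict
    inequality fails. Hence punctured neighbourhoods pull back to punctured neighbourhoods.\<close>
  have "filterlim ((*v) A) (at (A *v ?z)) (at ?z)"
  proof (rule filterlim_atI)
    show "((*v) A \<longlongrightarrow> A *v ?z) (at ?z)"
      by (intro isContD linear_continuous_at matrix_vector_mul_bounded_linear)
    show "\<forall>\<^sub>F z in at ?z. A *v z \<noteq> A *v ?z"
      unfolding eventually_at_filter using left_inv by (intro always_eventually allI impI) metis
  qed
  then have lim: "filterlim ((*v) A) (at x_star) (at ?z)" by (simp only: Az)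
  have ext: "strict_local_min (\<lambda>z. H (A *v z)) ?z \<or> strict_local_max (\<lambda>z. H (A *v z)) ?z"
    using assms(6) unfolding strict_local_min_def strict_local_max_def Az
    using eventually_compose_filterlim[OF _ lim] by blast
  have diffA: "(\<lambda>z. H (A *v z)) differentiable (at z)" for z
    using differentiable_chain_at[of "(*v) A" z H] diff
    by (simp add: o_def bounded_linear_imp_differentiable)
  show ?thesis
    using stable_equilibrium_hamiltonian[OF diff assms(6)]
      stable_equilibrium_hamiltonian[OF diffA ext] Az left_inv by auto
qed

end
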